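(* Let $d=2$ and consider on $H'_0$ the equation $$\frac{du_k}{dt}=-i\sum_{k_1\neq 0}(u_{k_1}|k)\,\Pi_k u_{k-k_1}-\nu|k|^2u_k+\Pi_k f_k(t),\qquad k\in\mathbb{Z}^2\setminus\{0\},$$ with $\nu>0$. Assume $f(t,\cdot)\in C^\infty$ uniformly with respect to $t\in\mathbb{R}$. Let $V^*=\nu^{-2}\sup_{t}V(f(t))$ and $V_0>V^*$. Then there exists a sequence of absorbing sets $\mathcal{A}_i$, $i\ge2$, for all symmetric Galerkin projections of the equation, and constants $C_i$, such that $$\mathcal{A}_i\subset\Big\{u\in H'_0:\ V(u)\le V_0,\ |u_k|\le\frac{C_i}{|k|^{\frac i2+1}}\ \forall k\ne0\Big\}.$$ Moreover, for every $s\in\mathbb{N}$ with $s\ge2$ there exists $C_s$ such that $$\mathcal{W}(V_0,s,C_s)=\{u\in H'_0: V(u)\le V_0,\ |u_k|\le C_s/|k|^s\ \forall k\neq0\}$$ is an absorbing set for all symmetric Galerkin projections of the equation.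
   Context: $(a|b)=\sum_i a_i\overline{b_i}$. $H=\ell_2(\mathbb{Z}^2,\mathbb{C}^2)$ is viewed as a real vector space. $H'=\{u\in H: u_{-k}=\overline{u_k},\ (u_k,k)=\sum_i(u_k)_ik_i=0\ \forall k\}$ and $H'_0=H'\cap\{u_0=0\}$. $\Pi_k$ is the orthogonal projection onto the orthogonal complement of $k$ in $\mathbb{C}^2$. The forcing $f(t,x)=\sum_kf_k(t)e^{i(k,x)}$ is real-valued with $f_0\equiv0$. "$f(t,\cdot)\in C^\infty$ uniformly in $t$" means $\sup_{t,k\ne0}|k|^\gamma|f_k(t)|<\infty$ for every $\gamma>0$. $V(u)=\sum_k|k|^2|u_k|^2$ is the enstrophy. $P_n$ is defined by $(P_nu)_k=u_k$ for $|k|\le n$ and $0$ otherwise. The symmetric Galerkin projections are the ODEs on $P_nH'_0$ consisting of the equations for $|k|\le n$ with $u=P_nu$. A set $\mathcal{A}$ is absorbing for a system if every trajectory of that system enters $\mathcal{A}$ after a finite time. *)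

theory Defs
  imports "HOL-Analysis.Analysis" "HOL-Library.Extended_Nonnegative_Real"
begin

text \<open>Wave vectors are elements of int \<times> int; vectors of C^2 are complex \<times> complex
  (the library norm on the product is the Euclidean norm).\<close>

type_synonym wv = "int \<times> int"
type_synonym c2 = "complex \<times> complex"
type_synonym field = "wv \<Rightarrow> c2"

definition knorm :: "wv \<Rightarrow> real" where
  "knorm k = sqrt ((real_of_int (fst k))\<^sup>2 + (real_of_int (snd k))\<^sup>2)"

definition cmul :: "complex \<Rightarrow> c2 \<Rightarrow> c2" where
  "cmul c v = (c * fst v, c * snd v)"

definition conj2 :: "c2 \<Rightarrow> c2" where
  "conj2 v = (cnj (fst v), cnj (snd v))"

text \<open>(v|k) = sum_i v_i conj(k_i) = v_1 k_1 + v_2 k_2, k being real.\<close>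
definition kdot :: "c2 \<Rightarrow> wv \<Rightarrow> complex" where
  "kdot v k = fst v * of_int (fst k) + snd v * of_int (snd k)"

definition kvec :: "wv \<Rightarrow> c2" where
  "kvec k = (of_int (fst k), of_int (snd k))"

definition Pik :: "wv \<Rightarrow> c2 \<Rightarrow> c2" where
  "Pik k v = v - cmul (kdot v k / complex_of_real ((knorm k)\<^sup>2)) (kvec k)"

definition Hp :: "field set" where
  "Hp = {u. (\<lambda>k. (norm (u k))\<^sup>2) summable_on UNIV
            \<and> (\<forall>k. u (- k) = conj2 (u k))
            \<and> (\<forall>k. kdot (u k) k = 0)}"

definition Hp0 :: "field set" where
  "Hp0 = Hp \<inter> {u. u 0 = 0}"

definition enstrophy :: "field \<Rightarrow> ennreal" where
  "enstrophy u = (\<Sum>\<^sub>\<infinity>k. ennreal ((knorm k)\<^sup>2 * (norm (u k))\<^sup>2))"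

definition PnHp0 :: "nat \<Rightarrow> field set" where
  "PnHp0 n = {u \<in> Hp0. \<forall>k. knorm k > real n \<longrightarrow> u k = 0}"

text \<open>Right-hand side of the Galerkin system of order n at mode k (for u = P_n u,
  the terms with |k1| > n vanish, so the sum is the finite sum below).\<close>
definition galerkin_rhs :: "real \<Rightarrow> (real \<Rightarrow> field) \<Rightarrow> nat \<Rightarrow> real \<Rightarrow> field \<Rightarrow> wv \<Rightarrow> c2" where
  "galerkin_rhs \<nu> f n t u k =
     cmul (- \<i>) (\<Sum>k1\<in>{k1. k1 \<noteq> 0 \<and> knorm k1 \<le> real n}. cmul (kdot (u k1) k) (Pik k (u (k - k1))))
     - cmul (complex_of_real (\<nu> * (knorm k)\<^sup>2)) (u k)
     + Pik k (f t k)"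

definition galerkin_traj :: "real \<Rightarrow> (real \<Rightarrow> field) \<Rightarrow> nat \<Rightarrow> real \<Rightarrow> (real \<Rightarrow> field) \<Rightarrow> bool" where
  "galerkin_traj \<nu> f n t0 u \<longleftrightarrow>
     (\<forall>t\<ge>t0. u t \<in> PnHp0 n) \<and>
     (\<forall>k t. k \<noteq> 0 \<and> knorm k \<le> real n \<and> t \<ge> t0 \<longrightarrow>
        ((\<lambda>\<tau>. u \<tau> k) has_vector_derivative galerkin_rhs \<nu> f n t (u t) k) (at t within {t0..}))"

definition absorbing :: "real \<Rightarrow> (real \<Rightarrow> field) \<Rightarrow> nat \<Rightarrow> field set \<Rightarrow> bool" where
  "absorbing \<nu> f n A \<longleftrightarrow>
     (\<forall>t0 u. galerkin_traj \<nu> f n t0 u \<longrightarrow> (\<exists>T. \<forall>t\<ge>T. u t \<in> A))"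

definition Wset :: "real \<Rightarrow> nat \<Rightarrow> real \<Rightarrow> field set" where
  "Wset V0 s C = {u \<in> Hp0. enstrophy u \<le> ennreal V0 \<and>
                  (\<forall>k. k \<noteq> 0 \<longrightarrow> norm (u k) \<le> C / (knorm k) ^ s)}"

end

theory Submission
  imports Defs
begin

text \<open>In two dimensions the nonlinear term conserves the enstrophy, also after symmetric truncation.
  Hence \<open>V' \<le> V(f) / \<nu> - \<nu> V\<close>, and \<open>V \<le> V0\<close> from some time on. Each mode is
  damped at rate \<open>\<nu> |k|\<^sup>2\<close>, so a bound \<open>D |k| powr - p\<close> for the nonlinear term and the forcing
  eventually forces \<open>|u\<^sub>k| \<le> (2 D / \<nu>) |k| powr - (p + 2)\<close>. The enstrophy bounds the nonlinear term
  by \<open>V0\<close>, which gives the decay exponent 2. If the exponent \<open>s\<close> is known, splitting the convolution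
  at \<open>|k\<^sub>1| = |k| / 2\<close> and using the enstrophy for one factor bounds the nonlinear term with
  \<open>p = s - 3/2\<close>, so that every step gains \<open>1/2\<close>. All constants are independent of the
  order of the projection; only the entry time is not.\<close>

section \<open>Differential inequalities\<close>

text \<open>As long as \<open>h\<close> stays above \<open>R\<close> it falls at rate at least
  \<open>c\<close>, so it reaches \<open>R\<close> in finite time. It cannot be above
  \<open>R\<close> later, because it would have had to fall since its last visit to the region
  below.\<close>

lemma eventually_le_of_derivative:
  fixes h h' :: "real \<Rightarrow> real"
  assumes deriv: "\<forall>\<^sub>F t in at_top. (h has_real_derivative h' t) (at t)"
    and decr: "\<forall>\<^sub>F t in at_top. h t > R \<longrightarrow> h' t \<le> - c"
    and "c > 0"
  shows "\<forall>\<^sub>F t in at_top. h t \<le> R"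
proof -
  from eventually_conj[OF deriv decr] obtain t1
    where t1: "\<And>t. t \<ge> t1 \<Longrightarrow> (h has_real_derivative h' t) (at t)"
              "\<And>t. t \<ge> t1 \<Longrightarrow> h t > R \<Longrightarrow> h' t \<le> - c"
    unfolding eventually_at_top_linorder by blast
  have descent: "h b \<le> h a - c * (b - a)"
    if ab: "t1 \<le> a" "a < b" and above: "\<And>t. a < t \<Longrightarrow> t < b \<Longrightarrow> h t > R" for a b
  proof -
    obtain z where z: "a < z" "z < b" "h b - h a = (b - a) * h' z"
      using MVT2[of a b h h'] ab t1(1) by (metis order_trans)
    have "h' z \<le> - c"
      using t1(2)[of z] above[of z] z ab by simp
    then have "(b - a) * h' z \<le> (b - a) * - c"
      using ab by (intro mult_left_mono) auto
    then show ?thesis using z by (simp add: algebra_simps)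
  qed
  have "\<exists>T\<ge>t1. h T \<le> R"
  proof (rule ccontr)
    assume "\<not> ?thesis"
    then have above: "\<And>t. t \<ge> t1 \<Longrightarrow> h t > R" by force
    \<comment> \<open>The line of slope \<open>- c\<close> through \<open>(t1, h t1)\<close> meets
      the level \<open>R\<close> at time \<open>b\<close>.\<close>
    define b where "b = t1 + (h t1 - R) / c"
    have "t1 < b" using above[of t1] \<open>c > 0\<close> by (simp add: b_def)
    then have "h b \<le> h t1 - c * (b - t1)" using descent[of t1 b] above by simp
    also have "\<dots> = R" using \<open>c > 0\<close> by (simp add: b_def)
    finally show False using above[of b] \<open>t1 < b\<close> by simp
  qed
  then obtain T where T: "T \<ge> t1" "h T \<le> R" by blast
  have "h b \<le> R" if "b \<ge> T" for b
  proof (rule ccontr)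
    assume b: "\<not> h b \<le> R"
    have cont: "continuous_on {T..b} h"
      by (intro continuous_at_imp_continuous_on ballI DERIV_isCont[OF t1(1)]) (use T in auto)
    have eq: "{x \<in> {T..b}. h x \<le> R} = {T..b} \<inter> h -` {..R}" by auto
    have "closed ({T..b} \<inter> h -` {..R})"
      by (intro continuous_closed_preimage cont) auto
    then have "compact {x \<in> {T..b}. h x \<le> R}"
      unfolding eq compact_eq_bounded_closed by (auto intro: bounded_subset)
    moreover have "{x \<in> {T..b}. h x \<le> R} \<noteq> {}" using T that by auto
    \<comment> \<open>\<open>s\<close> is the last time in \<open>{T..b}\<close> with
      \<open>h s \<le> R\<close>; between \<open>s\<close> and \<open>b\<close> the descent estimate
      applies.\<close>
    ultimately obtain s where s: "s \<in> {x \<in> {T..b}. h x \<le> R}"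
        "\<And>x. x \<in> {x \<in> {T..b}. h x \<le> R} \<Longrightarrow> x \<le> s"
      by (meson compact_attains_sup)
    have "s < b" using s b by (cases "s = b") auto
    have "h b \<le> h s - c * (b - s)"
    proof (rule descent)
      fix t assume t: "s < t" "t < b"
      then show "h t > R" using s(1) s(2)[of t] by force
    qed (use s T \<open>s < b\<close> in auto)
    moreover have "h s \<le> R" "c * (b - s) > 0" using s \<open>s < b\<close> \<open>c > 0\<close> by auto
    ultimately show False using b by linarith
  qed
  then show ?thesis unfolding eventually_at_top_linorder by blast
qed

lemma has_real_derivative_inner_self:
  fixes v :: "real \<Rightarrow> 'a::real_inner"
  assumes "(v has_vector_derivative v') (at t)"
  shows "((\<lambda>t. v t \<bullet> v t) has_real_derivative 2 * (v t \<bullet> v')) (at t)"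
proof -
  note deriv = assms[unfolded has_vector_derivative_def]
  show ?thesis
    using has_derivative_inner[OF deriv deriv] unfolding has_field_derivative_def
    by (rule has_derivative_eq_rhs) (auto simp: fun_eq_iff inner_commute algebra_simps)
qed

text \<open>Damping balances a forcing of size \<open>D\<close> at radius \<open>D / \<mu>\<close>.
  Beyond twice that radius half of the damping is left over, so the squared norm decreases there at
  rate at least \<open>\<mu> * R\<^sup>2\<close>.\<close>

lemma eventually_norm_le_of_damping:
  fixes v w :: "real \<Rightarrow> 'a::real_inner"
  assumes deriv: "\<forall>\<^sub>F t in at_top. (v has_vector_derivative w t - \<mu> *\<^sub>R v t) (at t)"
    and bound: "\<forall>\<^sub>F t in at_top. norm (w t) \<le> D"
    and "D > 0" "\<mu> > 0"
  shows "\<forall>\<^sub>F t in at_top. norm (v t) \<le> 2 * D / \<mu>"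
proof -
  define R where "R = 2 * D / \<mu>"
  have "R > 0" using assms by (simp add: R_def)
  have "\<forall>\<^sub>F t in at_top. v t \<bullet> v t \<le> R\<^sup>2"
  proof (rule eventually_le_of_derivative)
    show "\<forall>\<^sub>F t in at_top. ((\<lambda>t. v t \<bullet> v t) has_real_derivative
        2 * (v t \<bullet> (w t - \<mu> *\<^sub>R v t))) (at t)"
      using deriv by eventually_elim (rule has_real_derivative_inner_self)
    show "\<forall>\<^sub>F t in at_top. v t \<bullet> v t > R\<^sup>2 \<longrightarrow> 2 * (v t \<bullet> (w t - \<mu> *\<^sub>R v t)) \<le> - (\<mu> * R\<^sup>2)"
      using bound
    proof (eventually_elim, intro impI)
      fix t assume D: "norm (w t) \<le> D" and "v t \<bullet> v t > R\<^sup>2"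
      then have sq: "R\<^sup>2 < (norm (v t))\<^sup>2" by (simp add: power2_norm_eq_inner)
      then have "R < norm (v t)" using power_less_imp_less_base by (metis norm_ge_zero)
      then have "2 * D \<le> \<mu> * norm (v t)" using \<open>\<mu> > 0\<close> by (simp add: R_def field_simps)
      then have "norm (v t) * (2 * D) \<le> norm (v t) * (\<mu> * norm (v t))"
        by (intro mult_left_mono) auto
      moreover have "v t \<bullet> w t \<le> norm (v t) * D"
        using norm_cauchy_schwarz[of "v t" "w t"] mult_left_mono[OF D, of "norm (v t)"] by simp
      ultimately have "2 * (v t \<bullet> w t) \<le> \<mu> * (norm (v t))\<^sup>2"
        by (simp add: power2_eq_square algebra_simps)
      moreover have "\<mu> * R\<^sup>2 \<le> \<mu> * (norm (v t))\<^sup>2"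
        using sq \<open>\<mu> > 0\<close> by simp
      ultimately show "2 * (v t \<bullet> (w t - \<mu> *\<^sub>R v t)) \<le> - (\<mu> * R\<^sup>2)"
        by (simp add: inner_diff_right power2_norm_eq_inner)
    qed
    show "\<mu> * R\<^sup>2 > 0" using \<open>R > 0\<close> \<open>\<mu> > 0\<close> by simp
  qed
  then show ?thesis
  proof eventually_elim
    case (elim t)
    then have "(norm (v t))\<^sup>2 \<le> R\<^sup>2" by (simp add: power2_norm_eq_inner)
    then have "norm (v t) \<le> R" by (rule power2_le_imp_le) (use \<open>R > 0\<close> in simp)
    then show ?case by (simp only: R_def)
  qed
qed

section \<open>Wave vectors\<close>

text \<open>The map \<open>\<lambda>a. nat \<bar>a\<bar>\<close> is injective on each half line, so
  each half contributes at most one copy of the series.\<close>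

lemma sum_int_le:
  fixes g :: "nat \<Rightarrow> real"
  assumes "summable g" and nonneg: "\<And>n. g n \<ge> 0" and "finite A"
  shows "(\<Sum>a\<in>A. g (nat \<bar>a\<bar>)) \<le> 2 * suminf g"
proof -
  have half: "(\<Sum>a\<in>B. g (nat \<bar>a\<bar>)) \<le> suminf g" if "finite B" "inj_on (\<lambda>a. nat \<bar>a\<bar>) B" for B
  proof -
    have "(\<Sum>a\<in>B. g (nat \<bar>a\<bar>)) = sum g ((\<lambda>a. nat \<bar>a\<bar>) ` B)"
      using that by (simp add: sum.reindex)
    also have "\<dots> \<le> suminf g" using that assms by (intro sum_le_suminf) auto
    finally show ?thesis .
  qed
  have "(\<Sum>a\<in>A. g (nat \<bar>a\<bar>)) =
      (\<Sum>a\<in>A \<inter> {a. a \<ge> 0}. g (nat \<bar>a\<bar>)) + (\<Sum>a\<in>A \<inter> - {a. a \<ge> 0}. g (nat \<bar>a\<bar>))"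
    using sum.Int_Diff[OF \<open>finite A\<close>, of _ "{a. a \<ge> 0}"] by (simp only: Diff_eq)
  also have "\<dots> \<le> suminf g + suminf g"
    using \<open>finite A\<close> by (intro add_mono half) (auto simp: inj_on_def)
  finally show ?thesis by simp
qed

lemma knorm_nonneg [simp]: "knorm k \<ge> 0"
  by (simp add: knorm_def)

lemma knorm_0 [simp]: "knorm 0 = 0"
  by (simp add: knorm_def)

lemma knorm_minus [simp]: "knorm (- k) = knorm k"
  by (simp add: knorm_def)

lemma knorm_sq: "(knorm k)\<^sup>2 = (real_of_int (fst k))\<^sup>2 + (real_of_int (snd k))\<^sup>2"
  by (simp add: knorm_def)

lemma knorm_ge_fst: "\<bar>real_of_int (fst k)\<bar> \<le> knorm k"
  by (simp add: knorm_def real_sqrt_sum_squares_ge1 abs_le_square_iff real_le_rsqrt)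

lemma knorm_ge_snd: "\<bar>real_of_int (snd k)\<bar> \<le> knorm k"
  by (simp add: knorm_def abs_le_square_iff real_le_rsqrt)

lemma knorm_ge_1:
  assumes "k \<noteq> 0" shows "knorm k \<ge> 1"
proof -
  have "fst k \<noteq> 0 \<or> snd k \<noteq> 0" using assms by (simp add: prod_eq_iff)
  then have "\<bar>real_of_int (fst k)\<bar> \<ge> 1 \<or> \<bar>real_of_int (snd k)\<bar> \<ge> 1" by linarith
  then show ?thesis using knorm_ge_fst[of k] knorm_ge_snd[of k] by linarith
qed

lemma knorm_triangle: "knorm (j + k) \<le> knorm j + knorm k"
  unfolding knorm_def using real_sqrt_sum_squares_triangle_ineq by simp

lemma finite_knorm_le [simp]: "finite {k. knorm k \<le> r}"
proof (rule finite_subset)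
  have "\<bar>fst k\<bar> \<le> \<lfloor>r\<rfloor> \<and> \<bar>snd k\<bar> \<le> \<lfloor>r\<rfloor>" if "knorm k \<le> r" for k
    using that knorm_ge_fst[of k] knorm_ge_snd[of k] by (auto simp: le_floor_iff)
  then show "{k. knorm k \<le> r} \<subseteq> {- \<lfloor>r\<rfloor>..\<lfloor>r\<rfloor>} \<times> {- \<lfloor>r\<rfloor>..\<lfloor>r\<rfloor>}"
    by (force simp: abs_le_iff)
qed auto

text \<open>One plus the modulus of either coordinate is at most \<open>2 * knorm k\<close>, so the
  summand is dominated by a product of two one-dimensional terms with exponent
  \<open>- 3 / 2\<close>, whose series converge. A bound uniform over finite sets serves every
  truncation order at once.\<close>

lemma sum_inverse_knorm_cubed_bounded:
  obtains Z :: real where "Z \<ge> 0"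
    "\<And>F. finite F \<Longrightarrow> 0 \<notin> F \<Longrightarrow> (\<Sum>k\<in>F. 1 / (knorm k) ^ 3) \<le> Z"
proof
  \<comment> \<open>The shift by \<open>Suc\<close> keeps the base positive, since one coordinate of
    a nonzero wave vector may vanish.\<close>
  define g where "g n = real (Suc n) powr (- 3 / 2)" for n :: nat
  have g: "summable g" "\<And>n. g n \<ge> 0"
    using summable_real_powr_iff[of "- 3 / 2"] unfolding g_def
    by (subst summable_Suc_iff) auto
  define G where "G = 2 * suminf g"
  have G0: "G \<ge> 0" using g by (simp add: G_def suminf_nonneg)
  show "8 * (G * G) \<ge> 0" using G0 by simp
  fix F :: "wv set" assume F: "finite F" "0 \<notin> F"
  have pointwise: "1 / (knorm k) ^ 3 \<le> 8 * (g (nat \<bar>fst k\<bar>) * g (nat \<bar>snd k\<bar>))"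
    if "k \<noteq> 0" for k
  proof -
    define x y where "x = 1 + \<bar>real_of_int (fst k)\<bar>" and "y = 1 + \<bar>real_of_int (snd k)\<bar>"
    define m where "m = knorm k"
    have m: "m \<ge> 1" using knorm_ge_1[OF that] by (simp add: m_def)
    have xy: "x > 0" "y > 0" "x \<le> 2 * m" "y \<le> 2 * m"
      using knorm_ge_fst[of k] knorm_ge_snd[of k] m by (auto simp: x_def y_def m_def)
    have "(2 * m) powr (- 3 / 2) * (2 * m) powr (- 3 / 2) \<le> x powr (- 3 / 2) * y powr (- 3 / 2)"
      using xy m by (intro mult_mono powr_mono2') auto
    moreover have "(2 * m) powr (- 3 / 2) * (2 * m) powr (- 3 / 2) = 1 / (8 * m ^ 3)"
      using m by (simp flip: powr_add) (simp add: powr_minus_divide powr_numeral power_mult_distrib)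
    moreover have "g (nat \<bar>fst k\<bar>) = x powr (- 3 / 2)" "g (nat \<bar>snd k\<bar>) = y powr (- 3 / 2)"
      by (simp_all add: g_def x_def y_def)
    ultimately show ?thesis using m by (simp add: m_def field_simps)
  qed
  have "(\<Sum>k\<in>F. 1 / (knorm k) ^ 3) \<le> (\<Sum>k\<in>F. 8 * (g (nat \<bar>fst k\<bar>) * g (nat \<bar>snd k\<bar>)))"
    by (intro sum_mono pointwise) (use F in auto)
  also have "\<dots> \<le> (\<Sum>k\<in>fst ` F \<times> snd ` F. 8 * (g (nat \<bar>fst k\<bar>) * g (nat \<bar>snd k\<bar>)))"
    using F g by (intro sum_mono2) (auto simp: image_iff Bex_def intro: prod.collapse)
  also have "\<dots> = 8 * ((\<Sum>a\<in>fst ` F. g (nat \<bar>a\<bar>)) * (\<Sum>b\<in>snd ` F. g (nat \<bar>b\<bar>)))"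
    by (subst sum_product, subst sum.cartesian_product)
      (simp add: case_prod_beta flip: sum_distrib_left)
  also have "\<dots> \<le> 8 * (G * G)"
    using F g G0 unfolding G_def by (intro mult_left_mono mult_mono sum_int_le sum_nonneg) auto
  finally show "(\<Sum>k\<in>F. 1 / (knorm k) ^ 3) \<le> 8 * (G * G)" .
qed

section \<open>Algebra in C^2 and the projection orthogonal to a wave vector\<close>

text \<open>Bilinear, without conjugation: the triad sums become polynomial in the coefficients, and
  \<open>conj2\<close> in the first argument recovers the real inner product.\<close>

definition bdot :: "c2 \<Rightarrow> c2 \<Rightarrow> complex" where
  "bdot v w = fst v * fst w + snd v * snd w"

lemma norm_c2_sq: "(norm (v :: c2))\<^sup>2 = (norm (fst v))\<^sup>2 + (norm (snd v))\<^sup>2"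
  by (simp add: norm_prod_def)

lemma norm_cmul [simp]: "norm (cmul c v) = norm c * norm v"
proof -
  have "(norm (cmul c v))\<^sup>2 = (norm c * norm v)\<^sup>2"
    by (simp add: norm_c2_sq power_mult_distrib cmul_def norm_mult algebra_simps)
  then show ?thesis by (metis mult_nonneg_nonneg norm_ge_zero power2_eq_imp_eq)
qed

lemma cmul_of_real: "cmul (complex_of_real x) v = x *\<^sub>R v"
  by (simp add: cmul_def prod_eq_iff scaleR_conv_of_real)

lemma of_real_knorm_sq:
  "complex_of_real ((knorm k)\<^sup>2) = of_int (fst k) * of_int (fst k) + of_int (snd k) * of_int (snd k)"
  unfolding knorm_sq by (simp add: power2_eq_square)

lemma norm_kdot_le: "norm (kdot v k) \<le> norm v * knorm k"
proof -
  have "norm (kdot v k) \<le> norm (fst v) * \<bar>real_of_int (fst k)\<bar> + norm (snd v) * \<bar>real_of_int (snd k)\<bar>"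
    unfolding kdot_def by (rule norm_triangle_le) (simp add: norm_mult)
  also have "\<dots> = (norm (fst v), norm (snd v)) \<bullet> (\<bar>real_of_int (fst k)\<bar>, \<bar>real_of_int (snd k)\<bar>)"
    by simp
  also have "\<dots> \<le> norm (norm (fst v), norm (snd v)) * norm (\<bar>real_of_int (fst k)\<bar>, \<bar>real_of_int (snd k)\<bar>)"
    by (rule norm_cauchy_schwarz)
  also have "\<dots> = norm v * knorm k"
    by (simp add: norm_prod_def knorm_def)
  finally show ?thesis .
qed

lemma kdot_minus: "kdot v (- k) = - kdot v k"
  by (simp add: kdot_def)

lemma inner_c2_eq_bdot: "v \<bullet> w = Re (bdot (conj2 v) w)"
  by (simp add: inner_prod_def inner_complex_def bdot_def conj2_def)

lemma bdot_sum_right: "bdot v (sum g A) = (\<Sum>x\<in>A. bdot v (g x))"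
  by (induction A rule: infinite_finite_induct) (auto simp: bdot_def algebra_simps)

lemma bdot_diff_right: "bdot v (w - z) = bdot v w - bdot v z"
  by (simp add: bdot_def algebra_simps)

lemma bdot_cmul_right: "bdot v (cmul c w) = c * bdot v w"
  by (simp add: bdot_def cmul_def algebra_simps)

lemma bdot_kvec: "bdot v (kvec k) = kdot v k"
  by (simp add: bdot_def kvec_def kdot_def)

text \<open>The projection changes \<open>w\<close> only by a multiple of \<open>k\<close>, which a
  \<open>v\<close> orthogonal to \<open>k\<close> does not see.\<close>

lemma bdot_Pik: "kdot v k = 0 \<Longrightarrow> bdot v (Pik k w) = bdot v w"
  by (simp add: Pik_def bdot_diff_right bdot_cmul_right bdot_kvec)

lemma kdot_Pik: 
  assumes "k \<noteq> 0" shows "kdot (Pik k v) k = 0"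
proof -
  have "knorm k \<noteq> 0" using knorm_ge_1[OF assms] by simp
  then have *: "complex_of_real ((knorm k)\<^sup>2) \<noteq> 0" by simp
  have "kdot (Pik k v) k = kdot v k - kdot v k / complex_of_real ((knorm k)\<^sup>2) * complex_of_real ((knorm k)\<^sup>2)"
    unfolding of_real_knorm_sq Pik_def
    by (simp add: kdot_def kvec_def cmul_def algebra_simps add_divide_distrib)
  then show ?thesis using * by simp
qed

text \<open>Pythagoras, applied to \<open>v = Pik k v + (multiple of k)\<close>.\<close>
lemma norm_Pik_le: "norm (Pik k v) \<le> norm v"
proof (cases "k = 0")
  case True
  then show ?thesis by (simp add: Pik_def cmul_def kvec_def flip: zero_prod_def)
next
  case False
  define c where "c = kdot v k / complex_of_real ((knorm k)\<^sup>2)"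
  have v: "v = Pik k v + cmul c (kvec k)" by (simp add: Pik_def c_def)
  have "Pik k v \<bullet> cmul c (kvec k) = Re (cnj (kdot (Pik k v) k) * c)"
    unfolding inner_c2_eq_bdot by (simp add: bdot_def conj2_def cmul_def kvec_def kdot_def algebra_simps)
  then have "Pik k v \<bullet> cmul c (kvec k) = 0" using kdot_Pik[OF False] by simp
  then have "(norm v)\<^sup>2 = (norm (Pik k v))\<^sup>2 + (norm (cmul c (kvec k)))\<^sup>2"
    by (subst v) (simp add: power2_norm_eq_inner inner_add_left inner_add_right inner_commute
        del: norm_cmul)
  then have "(norm (Pik k v))\<^sup>2 \<le> (norm v)\<^sup>2" by simp
  then show ?thesis by (rule power2_le_imp_le) simp
qed

section \<open>The nonlinear term\<close>

abbreviation modes :: "nat \<Rightarrow> wv set" where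
  "modes n \<equiv> {k. knorm k \<le> real n}"

text \<open>The convolution in \<open>galerkin_rhs\<close> without its factor \<open>- \<i>\<close>,
  which does not affect norms.\<close>

definition nonlin :: "nat \<Rightarrow> field \<Rightarrow> wv \<Rightarrow> c2" where
  "nonlin n u k = (\<Sum>k1\<in>{k1. k1 \<noteq> 0 \<and> knorm k1 \<le> real n}. cmul (kdot (u k1) k) (Pik k (u (k - k1))))"

text \<open>The real summand of the \<open>ennreal\<close>-valued \<open>enstrophy\<close>; for a
  truncated field finite sums of it suffice, and these can be differentiated in time.\<close>

definition mode_enstrophy :: "field \<Rightarrow> wv \<Rightarrow> real" where
  "mode_enstrophy u k = (knorm k)\<^sup>2 * (norm (u k))\<^sup>2"

lemma mode_enstrophy_nonneg [simp]: "mode_enstrophy u k \<ge> 0"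
  by (simp add: mode_enstrophy_def)

lemma PnHp0_D:
  assumes "u \<in> PnHp0 n"
  shows "u 0 = 0" "kdot (u k) k = 0" "u (- k) = conj2 (u k)" "k \<notin> modes n \<Longrightarrow> u k = 0"
  using assms by (simp_all add: PnHp0_def Hp0_def Hp_def del: split_paired_All)

text \<open>Reindexing by \<open>\<sigma>\<close> shows that the sum equals its own
  negative.\<close>

lemma sum_eq_0_of_antisymmetric_involution:
  fixes F :: "'a \<Rightarrow> 'b::field_char_0"
  assumes "\<And>x. x \<in> T \<Longrightarrow> \<sigma> x \<in> T" "\<And>x. x \<in> T \<Longrightarrow> \<sigma> (\<sigma> x) = x" "\<And>x. x \<in> T \<Longrightarrow> F (\<sigma> x) = - F x"
  shows "sum F T = 0"
proof -
  have "sum F T = (\<Sum>x\<in>T. - F x)"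
    by (rule sum.reindex_bij_witness[of _ \<sigma> \<sigma>]) (use assms in auto)
  then have "2 * sum F T = 0" by (simp add: sum_negf)
  then show ?thesis by simp
qed

text \<open>Writing \<open>u\<^sub>k = \<phi>\<^sub>k k\<^sup>\<bottom>\<close>, the cubic form is a sum over triads \<open>a + b + c = 0\<close>.
  It splits into a part that is antisymmetric under exchanging \<open>b\<close> and \<open>c\<close> (transport of the
  vorticity) and a part that is antisymmetric under exchanging \<open>a\<close> and \<open>b\<close>.\<close>
lemma nonlin_enstrophy_conservation:
  assumes "u \<in> PnHp0 n"
  shows "(\<Sum>k\<in>modes n. (knorm k)\<^sup>2 * (u k \<bullet> cmul (- \<i>) (nonlin n u k))) = 0"
proof -
  note u = PnHp0_D[OF assms]
  define x y where "x k = complex_of_int (fst k)" and "y k = complex_of_int (snd k)" for k :: wv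
  have xy_minus: "x (- k) = - x k" "y (- k) = - y k" for k
    by (simp_all add: x_def y_def)
  have norm_xy: "complex_of_real ((knorm k)\<^sup>2) = x k * x k + y k * y k" for k
    unfolding of_real_knorm_sq x_def y_def ..
  \<comment> \<open>In the plane, orthogonality to \<open>k\<close> leaves one complex scalar: up to
    a factor \<open>\<i>\<close>, the Fourier coefficient of the stream function.\<close>
  have "\<exists>\<phi>. u k = (- \<phi> * y k, \<phi> * x k)" for k
  proof (cases "k = 0")
    case True then show ?thesis using u(1) by (intro exI[of _ 0]) (simp add: zero_prod_def)
  next
    case False
    have "complex_of_real ((knorm k)\<^sup>2) \<noteq> 0"
      using knorm_ge_1[OF False] by simp
    then have nz: "x k * x k + y k * y k \<noteq> 0" by (simp only: norm_xy not_False_eq_True)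
    obtain p q where pq: "u k = (p, q)" by (cases "u k")
    have orth: "p * x k + q * y k = 0" using u(2)[of k] by (simp add: kdot_def pq x_def y_def)
    define \<phi> where "\<phi> = (q * x k - p * y k) / (x k * x k + y k * y k)"
    have \<phi>: "\<phi> * (x k * x k + y k * y k) = q * x k - p * y k" using nz by (simp add: \<phi>_def)
    have "(p + \<phi> * y k) * (x k * x k + y k * y k) = 0" "(q - \<phi> * x k) * (x k * x k + y k * y k) = 0"
      using orth \<phi> by algebra+
    then have "p = - \<phi> * y k" "q = \<phi> * x k" using nz by (auto simp: add_eq_0_iff2)
    then show ?thesis using pq by auto
  qed
  then obtain \<phi> where \<phi>: "\<And>k. u k = (- \<phi> k * y k, \<phi> k * x k)" by metis
  \<comment> \<open>With \<open>a = k1\<close>, \<open>b = k - k1\<close> and \<open>c = - k\<close>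
    the double sum over \<open>k\<close> and \<open>k1\<close> runs over triads, and the truncation
    is symmetric in all three entries.\<close>
  define T where "T = {(a, b, c). a \<in> modes n \<and> b \<in> modes n \<and> c \<in> modes n \<and> a + b + c = 0}"
  define \<Phi> where "\<Phi> = (\<lambda>(a, b, c). - (x c * x c + y c * y c) * kdot (u a) c * bdot (u c) (u b))"
  define \<Phi>1 where "\<Phi>1 = (\<lambda>(a, b, c). kdot (u a) c * (\<phi> b * (x b * x b + y b * y b)) * (\<phi> c * (x c * x c + y c * y c)))"
  define \<Phi>2 where "\<Phi>2 = (\<lambda>(a, b, c). \<phi> a * \<phi> b * \<phi> c * (x a * y b - y a * x b) * (x a * x b + y a * y b) * (x c * x c + y c * y c))"
  have third: "c = - a - b" if "a + b + c = 0" for a b c :: wv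
    using that by (metis add.commute add_diff_cancel_left' diff_0 diff_diff_add minus_diff_eq)
  have xy_third: "x c = - x a - x b" "y c = - y a - y b" if "a + b + c = 0" for a b c
    unfolding third[OF that] by (simp_all add: x_def y_def)
  have kdot_u: "kdot (u a) c = - \<phi> a * (x a * y b - y a * x b)" if "a + b + c = 0" for a b c
    by (simp add: kdot_def \<phi> xy_third[OF that] algebra_simps flip: x_def y_def)
  have "\<Phi> p = \<Phi>1 p - \<Phi>2 p" if "p \<in> T" for p
  proof -
    obtain a b c where p: "p = (a, b, c)" by (cases p)
    have abc: "a + b + c = 0" using that by (simp add: T_def p)
    \<comment> \<open>Substituting \<open>c = - a - b\<close> splits the scalar product of
      \<open>b\<close> and \<open>c\<close>: the square of \<open>b\<close> leads to
      \<open>\<Phi>1\<close>, the product of \<open>a\<close> and \<open>b\<close> to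
      \<open>\<Phi>2\<close>.\<close>
    have "bdot (u c) (u b) = - \<phi> b * \<phi> c * ((x b * x b + y b * y b) + (x a * x b + y a * y b))"
      by (simp add: bdot_def \<phi> xy_third[OF abc] algebra_simps)
    then show ?thesis
      unfolding p \<Phi>_def \<Phi>1_def \<Phi>2_def prod.case kdot_u[OF abc] by algebra
  qed
  then have "sum \<Phi> T = sum \<Phi>1 T - sum \<Phi>2 T" by (simp add: sum_subtractf)
  moreover have "sum \<Phi>1 T = 0"
  proof (rule sum_eq_0_of_antisymmetric_involution)
    fix p assume "p \<in> T"
    obtain a b c where p: "p = (a, b, c)" by (cases p)
    have abc: "a + b + c = 0" using \<open>p \<in> T\<close> by (simp add: T_def p)
    then have acb: "a + c + b = 0" by (simp add: add_ac)
    show "(fst p, snd (snd p), fst (snd p)) \<in> T"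
      using \<open>p \<in> T\<close> acb by (simp add: T_def p)
    \<comment> \<open>Since \<open>c = - a - b\<close>, the cross product with \<open>a\<close>
      changes sign when \<open>b\<close> is replaced by \<open>c\<close>. Hence
      \<open>kdot (u a) c\<close> is odd under the exchange, while the two vorticity factors only
      trade places.\<close>
    have "x a * y c - y a * x c = - (x a * y b - y a * x b)"
      by (simp add: xy_third[OF abc] algebra_simps)
    then show "\<Phi>1 (fst p, snd (snd p), fst (snd p)) = - \<Phi>1 p"
      unfolding p \<Phi>1_def prod.case fst_conv snd_conv kdot_u[OF abc] kdot_u[OF acb] by algebra
  qed simp
  moreover have "sum \<Phi>2 T = 0"
  proof (rule sum_eq_0_of_antisymmetric_involution)
    fix p assume "p \<in> T"
    obtain a b c where p: "p = (a, b, c)" by (cases p)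
    show "(fst (snd p), fst p, snd (snd p)) \<in> T"
      using \<open>p \<in> T\<close> by (simp add: T_def p add_ac)
    show "\<Phi>2 (fst (snd p), fst p, snd (snd p)) = - \<Phi>2 p"
      unfolding p \<Phi>2_def prod.case fst_conv snd_conv by algebra
  qed simp
  ultimately have \<Phi>0: "sum \<Phi> T = 0" by simp
  \<comment> \<open>Reality turns the conjugate of \<open>u k\<close> into \<open>u (- k)\<close>,
    so the summands are trilinear in \<open>u\<close>. The real part is taken only at the
    end.\<close>
  have "(\<Sum>k\<in>modes n. complex_of_real ((knorm k)\<^sup>2) * bdot (u (- k)) (nonlin n u k))
      = (\<Sum>k\<in>modes n. \<Sum>k1\<in>modes n. \<Phi> (k1, k - k1, - k))"
  proof (intro sum.cong refl)
    fix k
    have "complex_of_real ((knorm k)\<^sup>2) * bdot (u (- k)) (nonlin n u k)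
        = (\<Sum>k1\<in>{k1. k1 \<noteq> 0 \<and> knorm k1 \<le> real n}. \<Phi> (k1, k - k1, - k))"
      unfolding nonlin_def bdot_sum_right sum_distrib_left
    proof (intro sum.cong refl)
      fix k1
      have "kdot (u (- k)) k = 0" using u(2)[of "- k"] by (simp add: kdot_minus)
      then show "complex_of_real ((knorm k)\<^sup>2) * bdot (u (- k)) (cmul (kdot (u k1) k) (Pik k (u (k - k1))))
          = \<Phi> (k1, k - k1, - k)"
        unfolding norm_xy
        by (simp add: bdot_cmul_right bdot_Pik \<Phi>_def xy_minus kdot_minus distrib_right left_diff_distrib)
    qed
    \<comment> \<open>The excluded index \<open>k1 = 0\<close> contributes nothing because
      \<open>u 0 = 0\<close>; including it gives all three legs the same range.\<close>
    also have "\<dots> = (\<Sum>k1\<in>modes n. \<Phi> (k1, k - k1, - k))"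
    proof (rule sum.mono_neutral_left)
      have "\<Phi> (0, k - 0, - k) = 0" by (simp add: \<Phi>_def kdot_def u(1))
      then show "\<forall>k1\<in>modes n - {k1. k1 \<noteq> 0 \<and> knorm k1 \<le> real n}. \<Phi> (k1, k - k1, - k) = 0"
        by blast
    qed auto
    finally show "complex_of_real ((knorm k)\<^sup>2) * bdot (u (- k)) (nonlin n u k)
        = (\<Sum>k1\<in>modes n. \<Phi> (k1, k - k1, - k))" .
  qed
  also have "\<dots> = (\<Sum>(k, k1)\<in>modes n \<times> modes n. \<Phi> (k1, k - k1, - k))"
    by (simp add: sum.cartesian_product)
  \<comment> \<open>Terms with \<open>k - k1\<close> beyond the truncation vanish, so the third leg
    may be truncated as well.\<close>
  also have "\<dots> = (\<Sum>(k, k1)\<in>{(k, k1). k \<in> modes n \<and> k1 \<in> modes n \<and> k - k1 \<in> modes n}. \<Phi> (k1, k - k1, - k))"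
  proof (rule sum.mono_neutral_right)
    show "\<forall>p\<in>modes n \<times> modes n - {(k, k1). k \<in> modes n \<and> k1 \<in> modes n \<and> k - k1 \<in> modes n}.
        (case p of (k, k1) \<Rightarrow> \<Phi> (k1, k - k1, - k)) = 0"
    proof
      fix p assume p: "p \<in> modes n \<times> modes n - {(k, k1). k \<in> modes n \<and> k1 \<in> modes n \<and> k - k1 \<in> modes n}"
      obtain k k1 where "p = (k, k1)" by (cases p)
      with p have "u (k - k1) = 0" by (intro u(4)) simp
      then show "(case p of (k, k1) \<Rightarrow> \<Phi> (k1, k - k1, - k)) = 0"
        by (simp add: \<open>p = (k, k1)\<close> \<Phi>_def bdot_def)
    qed
  qed auto
  also have "\<dots> = sum \<Phi> T"
  proof (rule sum.reindex_bij_witness[of _ "\<lambda>p. (- snd (snd p), fst p)" "\<lambda>p. (snd p, fst p - snd p, - fst p)"])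
    fix p assume "p \<in> T"
    obtain a b c where p: "p = (a, b, c)" by (cases p)
    have b: "b = - c - a" using \<open>p \<in> T\<close> third[of c a b] by (simp add: T_def p add_ac)
    show "(- snd (snd p), fst p) \<in> {(k, k1). k \<in> modes n \<and> k1 \<in> modes n \<and> k - k1 \<in> modes n}"
      using \<open>p \<in> T\<close> b by (simp add: T_def p)
    show "(snd (- snd (snd p), fst p), fst (- snd (snd p), fst p) - snd (- snd (snd p), fst p),
        - fst (- snd (snd p), fst p)) = p"
      by (simp add: p b)
  next
    fix p assume p: "p \<in> {(k, k1). k \<in> modes n \<and> k1 \<in> modes n \<and> k - k1 \<in> modes n}"
    obtain k k1 where k: "p = (k, k1)" by (cases p)
    show "(snd p, fst p - snd p, - fst p) \<in> T" using p by (simp add: T_def k)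
    show "(- snd (snd (snd p, fst p - snd p, - fst p)), fst (snd p, fst p - snd p, - fst p)) = p"
      by (simp add: k)
    show "\<Phi> (snd p, fst p - snd p, - fst p) = (case p of (k, k1) \<Rightarrow> \<Phi> (k1, k - k1, - k))"
      by (simp add: k)
  qed
  finally have sum0: "(\<Sum>k\<in>modes n. complex_of_real ((knorm k)\<^sup>2) * bdot (u (- k)) (nonlin n u k)) = 0"
    using \<Phi>0 by simp
  have "(\<Sum>k\<in>modes n. (knorm k)\<^sup>2 * (u k \<bullet> cmul (- \<i>) (nonlin n u k)))
      = Re (- \<i> * (\<Sum>k\<in>modes n. complex_of_real ((knorm k)\<^sup>2) * bdot (u (- k)) (nonlin n u k)))"
    unfolding sum_distrib_left Re_sum
    by (intro sum.cong refl) (simp add: inner_c2_eq_bdot bdot_cmul_right u(3))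
  then show ?thesis unfolding sum0 by simp
qed

section \<open>Finite sums, the enstrophy and a first bound on the convolution\<close>

text \<open>Serves the forcing, which is not truncated.\<close>

lemma sum_le_enstrophy:
  assumes "finite K"
  shows "ennreal (\<Sum>k\<in>K. mode_enstrophy u k) \<le> enstrophy u"
proof -
  have "ennreal (\<Sum>k\<in>K. mode_enstrophy u k) = (\<Sum>\<^sub>\<infinity>k\<in>K. ennreal (mode_enstrophy u k))"
    using assms by simp
  also have "\<dots> \<le> enstrophy u"
    unfolding enstrophy_def mode_enstrophy_def
    by (rule infsum_mono_neutral) (auto intro: nonneg_summable_on_complete)
  finally show ?thesis .
qed

text \<open>Modes beyond the truncation vanish, so real bounds along trajectories transfer back to
  \<open>enstrophy\<close>.\<close>

lemma enstrophy_PnHp0: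
  assumes "u \<in> PnHp0 n"
  shows "enstrophy u = ennreal (\<Sum>k\<in>modes n. mode_enstrophy u k)"
proof -
  have "enstrophy u = (\<Sum>\<^sub>\<infinity>k\<in>modes n. ennreal (mode_enstrophy u k))"
    unfolding enstrophy_def mode_enstrophy_def
    by (rule infsum_cong_neutral) (use PnHp0_D(4)[OF assms] in \<open>auto simp del: split_paired_All\<close>)
  also have "\<dots> = ennreal (\<Sum>k\<in>modes n. mode_enstrophy u k)" by simp
  finally show ?thesis .
qed

text \<open>Reflection and shift are injective and the modes outside \<open>modes n\<close> carry
  nothing. This controls the second factor of the convolution uniformly in \<open>k\<close>.\<close>

lemma sum_mode_enstrophy_shift_le:
  assumes "u \<in> PnHp0 n" "finite A"
  shows "(\<Sum>j\<in>A. mode_enstrophy u (k - j)) \<le> (\<Sum>j\<in>modes n. mode_enstrophy u j)"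
proof -
  have "(\<Sum>j\<in>A. mode_enstrophy u (k - j)) = (\<Sum>j\<in>(\<lambda>j. k - j) ` A. mode_enstrophy u j)"
    by (subst sum.reindex) (auto simp: inj_on_def)
  also have "\<dots> = (\<Sum>j\<in>(\<lambda>j. k - j) ` A \<inter> modes n. mode_enstrophy u j)"
  proof (rule sum.mono_neutral_right)
    show "\<forall>j\<in>(\<lambda>j. k - j) ` A - (\<lambda>j. k - j) ` A \<inter> modes n. mode_enstrophy u j = 0"
    proof
      fix j assume "j \<in> (\<lambda>j. k - j) ` A - (\<lambda>j. k - j) ` A \<inter> modes n"
      then have "u j = 0" by (intro PnHp0_D(4)[OF assms(1)]) blast
      then show "mode_enstrophy u j = 0" by (simp add: mode_enstrophy_def)
    qed
  qed (use assms in auto)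
  also have "\<dots> \<le> (\<Sum>j\<in>modes n. mode_enstrophy u j)"
    by (rule sum_mono2) auto
  finally show ?thesis .
qed

text \<open>Incompressibility allows to replace the factor \<open>k\<close> by \<open>k - k\<^sub>1\<close>.\<close>
lemma norm_nonlin_le:
  assumes "u \<in> PnHp0 n"
  shows "norm (nonlin n u k) \<le>
    (\<Sum>k1\<in>{k1. k1 \<noteq> 0 \<and> knorm k1 \<le> real n}. norm (u k1) * (knorm (k - k1) * norm (u (k - k1))))"
  unfolding nonlin_def
proof (rule sum_norm_le)
  fix k1
  have "kdot (u k1) k = kdot (u k1) (k - k1)"
    using PnHp0_D(2)[OF assms, of k1] by (simp add: kdot_def algebra_simps)
  then have "norm (kdot (u k1) k) \<le> norm (u k1) * knorm (k - k1)"
    using norm_kdot_le[of "u k1" "k - k1"] by simp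
  then have "norm (kdot (u k1) k) * norm (Pik k (u (k - k1)))
      \<le> (norm (u k1) * knorm (k - k1)) * norm (u (k - k1))"
    by (intro mult_mono norm_Pik_le) auto
  then show "norm (cmul (kdot (u k1) k) (Pik k (u (k - k1))))
      \<le> norm (u k1) * (knorm (k - k1) * norm (u (k - k1)))"
    by (simp add: mult.assoc)
qed

lemma finite_nonzero_modes [simp]: "finite {k1. k1 \<noteq> 0 \<and> knorm k1 \<le> real n}"
  by (rule finite_subset[OF _ finite_knorm_le[of "real n"]]) blast

text \<open>Each product is split into two squares. Since \<open>knorm k1 \<ge> 1\<close>, the first
  is at most a mode enstrophy, and the second already carries its weight. No decay of the modes
  enters, so the bootstrap can start here.\<close>

lemma norm_nonlin_le_enstrophy:
  assumes "u \<in> PnHp0 n"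
  shows "norm (nonlin n u k) \<le> (\<Sum>j\<in>modes n. mode_enstrophy u j)"
proof -
  let ?A = "{k1. k1 \<noteq> 0 \<and> knorm k1 \<le> real n}" and ?V = "\<Sum>j\<in>modes n. mode_enstrophy u j"
  have "norm (u j) * (knorm (k - j) * norm (u (k - j)))
      \<le> (mode_enstrophy u j + mode_enstrophy u (k - j)) / 2" if "j \<in> ?A" for j
  proof -
    have "knorm j \<ge> 1" using that knorm_ge_1[of j] by simp
    then have "1 * (norm (u j))\<^sup>2 \<le> (knorm j)\<^sup>2 * (norm (u j))\<^sup>2"
      by (intro mult_right_mono) auto
    moreover have "2 * norm (u j) * (knorm (k - j) * norm (u (k - j)))
        \<le> (norm (u j))\<^sup>2 + (knorm (k - j) * norm (u (k - j)))\<^sup>2"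
      by (rule sum_squares_bound)
    ultimately show ?thesis
      by (simp add: mode_enstrophy_def power_mult_distrib)
  qed
  then have "norm (nonlin n u k) \<le> (\<Sum>j\<in>?A. (mode_enstrophy u j + mode_enstrophy u (k - j)) / 2)"
    by (intro order_trans[OF norm_nonlin_le[OF assms]] sum_mono)
  also have "\<dots> = ((\<Sum>j\<in>?A. mode_enstrophy u j) + (\<Sum>j\<in>?A. mode_enstrophy u (k - j))) / 2"
    by (simp add: sum.distrib flip: sum_divide_distrib)
  also have "\<dots> \<le> (?V + ?V) / 2"
  proof -
    have "(\<Sum>j\<in>?A. mode_enstrophy u j) \<le> ?V" by (rule sum_mono2) auto
    moreover have "(\<Sum>j\<in>?A. mode_enstrophy u (k - j)) \<le> ?V"
      by (rule sum_mode_enstrophy_shift_le[OF assms]) simp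
    ultimately show ?thesis by simp
  qed
  finally show ?thesis by simp
qed

section \<open>Transfer of decay through the convolution\<close>

text \<open>Here \<open>q\<close>, \<open>a\<close>, \<open>b\<close> are the lengths of
  \<open>k\<close>, \<open>k1\<close>, \<open>k - k1\<close>, and \<open>U\<close>, \<open>W\<close>
  the sizes of the two modes. One of \<open>a\<close>, \<open>b\<close> is at least
  \<open>q / 2\<close>, and the decay is used for that mode. Each term on the right is summable over
  \<open>k1\<close>, by the lattice sum or by the enstrophy. The bound on \<open>W\<close> is
  conditional because \<open>k1 = k\<close> gives \<open>b = 0\<close>.\<close>

lemma triad_bound:
  fixes q a b U W C s :: real
  assumes "q \<ge> 1" "a \<ge> 1" "q \<le> a + b" "s \<ge> 2" "C \<ge> 0" "U \<ge> 0" "W \<ge> 0"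
    and U: "U \<le> C / a powr s" and W: "b > 0 \<Longrightarrow> W \<le> C / b powr s"
  shows "2 * (U * (b * W)) \<le> q powr (3 / 2 - s) *
    (C\<^sup>2 * 2 powr (2 * s - 3) / a ^ 3 + b\<^sup>2 * W\<^sup>2 + C * 2 powr (s - 1) * (1 / a ^ 3 + a\<^sup>2 * U\<^sup>2))"
proof (cases "a \<ge> q / 2")
  case True
  \<comment> \<open>The weight \<open>r\<close> is the target rate. Of the decay of \<open>U\<close>
    squared, three powers of \<open>a\<close> are kept for the summation; the remaining exponent
    \<open>3 - 2 * s\<close> is negative, so \<open>a \<ge> q / 2\<close> turns it into the square
    of \<open>r\<close> up to a constant.\<close>
  define r where "r = q powr (3 / 2 - s)"
  have r: "r > 0" using assms by (simp add: r_def)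
  have "0 \<le> (U - r * (b * W))\<^sup>2 / r" using r by simp
  also have "\<dots> = U\<^sup>2 / r - 2 * (U * (b * W)) + r * (b * W)\<^sup>2"
    using r by (simp add: power2_eq_square field_simps)
  finally have amgm: "2 * (U * (b * W)) \<le> U\<^sup>2 / r + r * (b\<^sup>2 * W\<^sup>2)" by (simp add: power_mult_distrib)
  have "U\<^sup>2 \<le> (C / a powr s)\<^sup>2" using U assms by (intro power_mono) auto
  also have "\<dots> = C\<^sup>2 / a ^ 3 * a powr (3 - 2 * s)"
    using assms by (simp add: power_divide powr_diff powr_power mult.commute powr_numeral)
  also have "\<dots> \<le> C\<^sup>2 / a ^ 3 * (q / 2) powr (3 - 2 * s)"
    using assms True by (intro mult_left_mono powr_mono2') auto
  also have "(q / 2) powr (3 - 2 * s) = q powr (3 - 2 * s) * 2 powr (2 * s - 3)"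
    using assms powr_minus_divide[of 2 "3 - 2 * s"] by (simp add: powr_divide)
  also have "q powr (3 - 2 * s) = r\<^sup>2"
    using assms by (simp add: r_def powr_power algebra_simps)
  finally have "U\<^sup>2 / r \<le> r * (C\<^sup>2 * 2 powr (2 * s - 3) / a ^ 3)"
    using r by (simp add: field_simps power2_eq_square)
  moreover have "0 \<le> r * (C * 2 powr (s - 1) * (1 / a ^ 3 + a\<^sup>2 * U\<^sup>2))"
    using r assms by (intro mult_nonneg_nonneg add_nonneg_nonneg) auto
  ultimately show ?thesis using amgm unfolding r_def[symmetric] by (simp add: distrib_left)
next
  case False
  then have b: "b \<ge> q / 2" "b > 0" using assms by auto
  have "b * W \<le> b * (C / b powr s)" using W[OF b(2)] b by (intro mult_left_mono) auto
  also have "\<dots> = C * b powr (1 - s)" using b by (simp add: powr_diff)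
  also have "\<dots> \<le> C * (q / 2) powr (1 - s)"
    using assms b by (intro mult_left_mono powr_mono2') auto
  also have "\<dots> = C * 2 powr (s - 1) * q powr (1 - s)"
    using assms by (simp add: powr_divide powr_diff)
  finally have bW: "b * W \<le> C * 2 powr (s - 1) * q powr (1 - s)" .
  \<comment> \<open>Splitting \<open>U\<close> with weight \<open>sqrt q\<close> costs half a power:
    \<open>b * W\<close> has rate \<open>1 - s\<close>, the product \<open>3 / 2 - s\<close>. The
    weight absorbs one power of \<open>a\<close>, as \<open>a \<le> q\<close> in this case.\<close>
  define h where "h = sqrt q"
  have h: "h > 0" "h\<^sup>2 = q" "h = q powr (1 / 2)" using assms by (simp_all add: h_def powr_half_sqrt)
  have "0 \<le> (1 / a - h * a * U)\<^sup>2 / h" using h by simp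
  also have "\<dots> = 1 / (h * a\<^sup>2) - 2 * U + h * (a\<^sup>2 * U\<^sup>2)"
    using h(1) assms by (simp add: power2_eq_square field_simps)
  finally have "2 * U \<le> 1 / (h * a\<^sup>2) + h * (a\<^sup>2 * U\<^sup>2)" by simp
  moreover have "1 / (h * a\<^sup>2) \<le> h * (1 / a ^ 3)"
  proof -
    have "a \<le> h * h" using False assms h(2) by (simp add: power2_eq_square)
    then show ?thesis using h(1) assms by (simp add: divide_simps power2_eq_square power3_eq_cube)
  qed
  ultimately have U2: "2 * U \<le> h * (1 / a ^ 3 + a\<^sup>2 * U\<^sup>2)" by (simp add: distrib_left)
  have "2 * U * (b * W) \<le> h * (1 / a ^ 3 + a\<^sup>2 * U\<^sup>2) * (C * 2 powr (s - 1) * q powr (1 - s))"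
    using b assms h(1) by (intro mult_mono[OF U2 bW]) auto
  also have "\<dots> = (h * q powr (1 - s)) * (C * 2 powr (s - 1) * (1 / a ^ 3 + a\<^sup>2 * U\<^sup>2))"
    by (simp add: mult_ac)
  also have "h * q powr (1 - s) = q powr (3 / 2 - s)"
    unfolding h(3) by (simp flip: powr_add)
  finally have "2 * (U * (b * W)) \<le> q powr (3 / 2 - s) * (C * 2 powr (s - 1) * (1 / a ^ 3 + a\<^sup>2 * U\<^sup>2))"
    by (simp add: mult.assoc)
  also have "\<dots> \<le> q powr (3 / 2 - s) *
    (C\<^sup>2 * 2 powr (2 * s - 3) / a ^ 3 + b\<^sup>2 * W\<^sup>2 + C * 2 powr (s - 1) * (1 / a ^ 3 + a\<^sup>2 * U\<^sup>2))"
    using assms by (intro mult_left_mono) auto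
  finally show ?thesis .
qed

text \<open>Summing \<open>triad_bound\<close> over \<open>k1\<close> leaves only lattice sums,
  bounded by \<open>Z\<close>, and enstrophies, bounded by \<open>V\<close>; hence the constant does
  not involve \<open>n\<close>.\<close>

lemma norm_nonlin_le_powr:
  assumes u: "u \<in> PnHp0 n" and V: "(\<Sum>j\<in>modes n. mode_enstrophy u j) \<le> V"
    and decay: "\<And>k. k \<noteq> 0 \<Longrightarrow> norm (u k) \<le> C / knorm k powr s"
    and "s \<ge> 2" "C \<ge> 0" "k \<noteq> 0"
    and Z: "\<And>F. finite F \<Longrightarrow> 0 \<notin> F \<Longrightarrow> (\<Sum>k\<in>F. 1 / (knorm k) ^ 3) \<le> Z"
  shows "norm (nonlin n u k) \<le>
    (C\<^sup>2 * 2 powr (2 * s - 3) * Z + V + C * 2 powr (s - 1) * (Z + V)) * knorm k powr (3 / 2 - s)"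
proof -
  let ?A = "{k1. k1 \<noteq> 0 \<and> knorm k1 \<le> real n}" and ?r = "knorm k powr (3 / 2 - s)"
  let ?c = "C\<^sup>2 * 2 powr (2 * s - 3)" and ?d = "C * 2 powr (s - 1)"
  have "norm (nonlin n u k) \<le> 2 * (\<Sum>j\<in>?A. norm (u j) * (knorm (k - j) * norm (u (k - j))))"
    using norm_nonlin_le[OF u, of k] norm_ge_zero[of "nonlin n u k"] by linarith
  also have "\<dots> = (\<Sum>j\<in>?A. 2 * (norm (u j) * (knorm (k - j) * norm (u (k - j)))))"
    by (simp add: sum_distrib_left)
  also have "\<dots> \<le> (\<Sum>j\<in>?A. ?r * (?c / (knorm j) ^ 3 + (knorm (k - j))\<^sup>2 * (norm (u (k - j)))\<^sup>2
      + ?d * (1 / (knorm j) ^ 3 + (knorm j)\<^sup>2 * (norm (u j))\<^sup>2)))"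
  proof (rule sum_mono, rule triad_bound)
    fix j assume j: "j \<in> ?A"
    show "knorm k \<ge> 1" "knorm j \<ge> 1" using knorm_ge_1 \<open>k \<noteq> 0\<close> j by simp_all
    show "knorm k \<le> knorm j + knorm (k - j)" using knorm_triangle[of j "k - j"] by simp
    show "norm (u j) \<le> C / knorm j powr s" using decay j by simp
    show "norm (u (k - j)) \<le> C / knorm (k - j) powr s" if "knorm (k - j) > 0"
      using that by (intro decay) (metis knorm_0 less_irrefl)
  qed (use assms in auto)
  also have "\<dots> = ?r * (?c * (\<Sum>j\<in>?A. 1 / (knorm j) ^ 3) + (\<Sum>j\<in>?A. mode_enstrophy u (k - j))
      + ?d * ((\<Sum>j\<in>?A. 1 / (knorm j) ^ 3) + (\<Sum>j\<in>?A. mode_enstrophy u j)))"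
    by (simp add: mode_enstrophy_def sum.distrib sum_distrib_left distrib_left)
  also have "\<dots> \<le> ?r * (?c * Z + V + ?d * (Z + V))"
  proof -
    have Zb: "(\<Sum>j\<in>?A. 1 / (knorm j) ^ 3) \<le> Z" by (rule Z) auto
    have "(\<Sum>j\<in>?A. mode_enstrophy u (k - j)) \<le> V"
      using sum_mode_enstrophy_shift_le[OF u, of ?A k] V by simp
    moreover have "(\<Sum>j\<in>?A. mode_enstrophy u j) \<le> (\<Sum>j\<in>modes n. mode_enstrophy u j)"
      by (rule sum_mono2) auto
    ultimately show ?thesis using Zb V \<open>C \<ge> 0\<close>
      by (intro mult_left_mono add_mono order_refl) auto
  qed
  finally show ?thesis by (simp add: mult.commute)
qed

section \<open>Galerkin trajectories\<close>

text \<open>After \<open>t0\<close> the one-sided derivative is two-sided. The equation is arranged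
  as a source minus linear damping, as \<open>eventually_norm_le_of_damping\<close> expects.\<close>

lemma galerkin_traj_eventually:
  assumes "galerkin_traj \<nu> f n t0 u"
  shows "\<forall>\<^sub>F t in at_top. u t \<in> PnHp0 n"
    and "k \<noteq> 0 \<Longrightarrow> k \<in> modes n \<Longrightarrow> \<forall>\<^sub>F t in at_top. ((\<lambda>\<tau>. u \<tau> k) has_vector_derivative
      (cmul (- \<i>) (nonlin n (u t) k) + Pik k (f t k)) - (\<nu> * (knorm k)\<^sup>2) *\<^sub>R u t k) (at t)"
proof -
  show "\<forall>\<^sub>F t in at_top. u t \<in> PnHp0 n"
    using eventually_ge_at_top[of t0]
    by eventually_elim (use assms in \<open>simp add: galerkin_traj_def\<close>)
  assume k: "k \<noteq> 0" "k \<in> modes n"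
  show "\<forall>\<^sub>F t in at_top. ((\<lambda>\<tau>. u \<tau> k) has_vector_derivative
      (cmul (- \<i>) (nonlin n (u t) k) + Pik k (f t k)) - (\<nu> * (knorm k)\<^sup>2) *\<^sub>R u t k) (at t)"
    using eventually_gt_at_top[of t0]
  proof eventually_elim
    case (elim t)
    then have "((\<lambda>\<tau>. u \<tau> k) has_vector_derivative galerkin_rhs \<nu> f n t (u t) k) (at t within {t0..})"
      using assms k unfolding galerkin_traj_def by (simp del: split_paired_All)
    moreover have "at t within {t0..} = at t"
      by (rule at_within_interior) (use elim in simp)
    ultimately show ?case
      by (simp only: galerkin_rhs_def nonlin_def cmul_of_real diff_add_eq)
  qed
qed

text \<open>The nonlinear term cancels. Young's inequality with weight \<open>\<nu>\<close> lets
  half of the dissipation absorb the forcing, since \<open>knorm k \<ge> 1\<close> on nonzero modes;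
  the other half remains.\<close>

lemma enstrophy_rate_le:
  assumes "\<nu> > 0" and u: "u \<in> PnHp0 n"
  shows "(\<Sum>k\<in>modes n. (knorm k)\<^sup>2 * (2 * (u k \<bullet> (cmul (- \<i>) (nonlin n u k) + Pik k (g k)
            - (\<nu> * (knorm k)\<^sup>2) *\<^sub>R u k))))
    \<le> (\<Sum>k\<in>modes n. mode_enstrophy g k) / \<nu> - \<nu> * (\<Sum>k\<in>modes n. mode_enstrophy u k)"
proof -
  have "(knorm k)\<^sup>2 * (2 * (u k \<bullet> (cmul (- \<i>) (nonlin n u k) + Pik k (g k) - (\<nu> * (knorm k)\<^sup>2) *\<^sub>R u k)))
      \<le> 2 * ((knorm k)\<^sup>2 * (u k \<bullet> cmul (- \<i>) (nonlin n u k)))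
        + (mode_enstrophy g k / \<nu> - \<nu> * mode_enstrophy u k)" for k
  proof (cases "k = 0")
    case False
    define q where "q = (knorm k)\<^sup>2"
    have q: "q \<ge> 1" using knorm_ge_1[OF False] by (simp add: q_def)
    have "0 \<le> (norm (g k) - \<nu> * norm (u k))\<^sup>2 / \<nu>" using \<open>\<nu> > 0\<close> by simp
    also have "\<dots> = (norm (g k))\<^sup>2 / \<nu> - 2 * (norm (u k) * norm (g k)) + \<nu> * (norm (u k))\<^sup>2"
      using \<open>\<nu> > 0\<close> by (simp add: power2_eq_square field_simps)
    finally have "2 * (norm (u k) * norm (g k)) \<le> (norm (g k))\<^sup>2 / \<nu> + \<nu> * (norm (u k))\<^sup>2" by simp
    moreover have "u k \<bullet> Pik k (g k) \<le> norm (u k) * norm (g k)"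
      using norm_cauchy_schwarz[of "u k" "Pik k (g k)"]
        mult_left_mono[OF norm_Pik_le[of k "g k"], of "norm (u k)"] by simp
    moreover have "\<nu> * (norm (u k))\<^sup>2 * 1 \<le> \<nu> * (norm (u k))\<^sup>2 * q"
      using q \<open>\<nu> > 0\<close> by (intro mult_left_mono) auto
    ultimately have "2 * (u k \<bullet> Pik k (g k)) - 2 * (\<nu> * q * (norm (u k))\<^sup>2)
        \<le> (norm (g k))\<^sup>2 / \<nu> - \<nu> * (norm (u k))\<^sup>2"
      by (simp add: mult_ac)
    then have "q * (2 * (u k \<bullet> Pik k (g k)) - 2 * (\<nu> * q * (norm (u k))\<^sup>2))
        \<le> q * ((norm (g k))\<^sup>2 / \<nu> - \<nu> * (norm (u k))\<^sup>2)"
      using q by (intro mult_left_mono) auto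
    then show ?thesis unfolding mode_enstrophy_def q_def[symmetric]
      by (simp add: inner_add_right inner_diff_right power2_norm_eq_inner algebra_simps)
  qed (simp add: mode_enstrophy_def)
  then have "(\<Sum>k\<in>modes n. (knorm k)\<^sup>2 * (2 * (u k \<bullet> (cmul (- \<i>) (nonlin n u k) + Pik k (g k)
            - (\<nu> * (knorm k)\<^sup>2) *\<^sub>R u k))))
      \<le> (\<Sum>k\<in>modes n. 2 * ((knorm k)\<^sup>2 * (u k \<bullet> cmul (- \<i>) (nonlin n u k)))
        + (mode_enstrophy g k / \<nu> - \<nu> * mode_enstrophy u k))"
    by (rule sum_mono)
  also have "\<dots> = 2 * (\<Sum>k\<in>modes n. (knorm k)\<^sup>2 * (u k \<bullet> cmul (- \<i>) (nonlin n u k)))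
      + ((\<Sum>k\<in>modes n. mode_enstrophy g k) / \<nu> - \<nu> * (\<Sum>k\<in>modes n. mode_enstrophy u k))"
    by (simp only: sum.distrib sum_subtractf sum_distrib_left sum_divide_distrib)
  finally show ?thesis unfolding nonlin_enstrophy_conservation[OF u] by simp
qed

text \<open>By the rate estimate the enstrophy falls whenever it exceeds
  \<open>S / \<nu>\<^sup>2\<close>; the strict gap to \<open>V\<close> provides a positive rate of
  descent.\<close>

lemma galerkin_traj_eventually_enstrophy_le:
  assumes traj: "galerkin_traj \<nu> f n t0 u" and "\<nu> > 0"
    and S: "\<And>t. (\<Sum>k\<in>modes n. mode_enstrophy (f t) k) \<le> S" and "S < \<nu>\<^sup>2 * V"
  shows "\<forall>\<^sub>F t in at_top. (\<Sum>k\<in>modes n. mode_enstrophy (u t) k) \<le> V"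
proof (rule eventually_le_of_derivative)
  let ?w = "\<lambda>t k. cmul (- \<i>) (nonlin n (u t) k) + Pik k (f t k) - (\<nu> * (knorm k)\<^sup>2) *\<^sub>R u t k"
  \<comment> \<open>Finitely many modes share a common starting time. The mode 0 has weight zero and
    is treated separately.\<close>
  have "\<forall>\<^sub>F t in at_top. \<forall>k\<in>modes n - {0}. ((\<lambda>\<tau>. u \<tau> k) has_vector_derivative ?w t k) (at t)"
  proof (intro eventually_ball_finite ballI)
    fix k assume "k \<in> modes n - {0}"
    then have "k \<noteq> 0" "k \<in> modes n" by simp_all
    then show "\<forall>\<^sub>F t in at_top. ((\<lambda>\<tau>. u \<tau> k) has_vector_derivative ?w t k) (at t)"
      by (rule galerkin_traj_eventually(2)[OF traj])
  qed simp
  then show "\<forall>\<^sub>F t in at_top. ((\<lambda>t. \<Sum>k\<in>modes n. mode_enstrophy (u t) k) has_real_derivative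
      (\<Sum>k\<in>modes n. (knorm k)\<^sup>2 * (2 * (u t k \<bullet> ?w t k)))) (at t)"
  proof eventually_elim
    case (elim t)
    show ?case
    proof (rule DERIV_sum)
      fix k assume k: "k \<in> modes n"
      show "((\<lambda>t. mode_enstrophy (u t) k) has_real_derivative (knorm k)\<^sup>2 * (2 * (u t k \<bullet> ?w t k))) (at t)"
      proof (cases "k = 0")
        case False
        then have "((\<lambda>\<tau>. u \<tau> k) has_vector_derivative ?w t k) (at t)" using elim k by blast
        then have "((\<lambda>\<tau>. u \<tau> k \<bullet> u \<tau> k) has_real_derivative 2 * (u t k \<bullet> ?w t k)) (at t)"
          by (rule has_real_derivative_inner_self)
        then show ?thesis unfolding mode_enstrophy_def power2_norm_eq_inner by (rule DERIV_cmult)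
      qed (simp add: mode_enstrophy_def)
    qed
  qed
  show "\<forall>\<^sub>F t in at_top. (\<Sum>k\<in>modes n. mode_enstrophy (u t) k) > V \<longrightarrow>
      (\<Sum>k\<in>modes n. (knorm k)\<^sup>2 * (2 * (u t k \<bullet> ?w t k))) \<le> - (\<nu> * V - S / \<nu>)"
    using galerkin_traj_eventually(1)[OF traj]
  proof (eventually_elim, intro impI)
    fix t assume ut: "u t \<in> PnHp0 n" and V: "(\<Sum>k\<in>modes n. mode_enstrophy (u t) k) > V"
    have "(\<Sum>k\<in>modes n. mode_enstrophy (f t) k) / \<nu> \<le> S / \<nu>"
      using S \<open>\<nu> > 0\<close> by (simp add: divide_right_mono)
    moreover have "\<nu> * V \<le> \<nu> * (\<Sum>k\<in>modes n. mode_enstrophy (u t) k)"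
      using V \<open>\<nu> > 0\<close> by simp
    ultimately show "(\<Sum>k\<in>modes n. (knorm k)\<^sup>2 * (2 * (u t k \<bullet> ?w t k))) \<le> - (\<nu> * V - S / \<nu>)"
      using enstrophy_rate_le[OF \<open>\<nu> > 0\<close> ut, of "f t"] by linarith
  qed
  show "\<nu> * V - S / \<nu> > 0"
    using \<open>S < \<nu>\<^sup>2 * V\<close> \<open>\<nu> > 0\<close> by (simp add: field_simps power2_eq_square)
qed

text \<open>The damping rate \<open>\<nu> * (knorm k)\<^sup>2\<close> supplies the two extra powers.
  Only finitely many modes are active, so they have a common entry time, which may depend on
  \<open>n\<close> although the bound does not.\<close>

lemma galerkin_traj_eventually_decay:
  assumes traj: "galerkin_traj \<nu> f n t0 u" and "\<nu> > 0" "D > 0"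
    and bound: "\<forall>\<^sub>F t in at_top. \<forall>k. k \<noteq> 0 \<longrightarrow>
      norm (nonlin n (u t) k) + norm (f t k) \<le> D * knorm k powr - p"
  shows "\<forall>\<^sub>F t in at_top. \<forall>k. k \<noteq> 0 \<longrightarrow> norm (u t k) \<le> (2 * D / \<nu>) / knorm k powr (p + 2)"
proof -
  have "\<forall>\<^sub>F t in at_top. \<forall>k\<in>modes n - {0}. norm (u t k) \<le> (2 * D / \<nu>) / knorm k powr (p + 2)"
  proof (rule eventually_ball_finite, simp, rule ballI)
    fix k assume k: "k \<in> modes n - {0}"
    then have k1: "knorm k \<ge> 1" using knorm_ge_1[of k] by simp
    have "\<forall>\<^sub>F t in at_top. norm (u t k) \<le> 2 * (D * knorm k powr - p) / (\<nu> * (knorm k)\<^sup>2)"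
    proof (rule eventually_norm_le_of_damping)
      show "\<forall>\<^sub>F t in at_top. ((\<lambda>\<tau>. u \<tau> k) has_vector_derivative
          (cmul (- \<i>) (nonlin n (u t) k) + Pik k (f t k)) - (\<nu> * (knorm k)\<^sup>2) *\<^sub>R u t k) (at t)"
        by (rule galerkin_traj_eventually(2)[OF traj]) (use k in simp_all)
      show "\<forall>\<^sub>F t in at_top. norm (cmul (- \<i>) (nonlin n (u t) k) + Pik k (f t k)) \<le> D * knorm k powr - p"
        using bound
      proof eventually_elim
        case (elim t)
        have "norm (cmul (- \<i>) (nonlin n (u t) k) + Pik k (f t k))
            \<le> norm (nonlin n (u t) k) + norm (Pik k (f t k))"
          by (rule norm_triangle_le) simp
        also have "\<dots> \<le> norm (nonlin n (u t) k) + norm (f t k)"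
          using norm_Pik_le by simp
        also have "\<dots> \<le> D * knorm k powr - p" using elim k by blast
        finally show ?case .
      qed
    qed (use k1 \<open>\<nu> > 0\<close> \<open>D > 0\<close> in auto)
    also have "2 * (D * knorm k powr - p) / (\<nu> * (knorm k)\<^sup>2) = (2 * D / \<nu>) / knorm k powr (p + 2)"
      using k1 by (simp add: powr_minus_divide powr_add powr_numeral)
    finally show "\<forall>\<^sub>F t in at_top. norm (u t k) \<le> (2 * D / \<nu>) / knorm k powr (p + 2)" .
  qed
  with galerkin_traj_eventually(1)[OF traj] show ?thesis
  proof eventually_elim
    case (elim t)
    show ?case
    proof (intro allI impI)
      fix k :: wv assume "k \<noteq> 0"
      show "norm (u t k) \<le> (2 * D / \<nu>) / knorm k powr (p + 2)"
      proof (cases "k \<in> modes n")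
        case True then show ?thesis using elim(2) \<open>k \<noteq> 0\<close> by blast
      next
        case False
        then have "u t k = 0" by (rule PnHp0_D(4)[OF elim(1)])
        then show ?thesis using \<open>\<nu> > 0\<close> \<open>D > 0\<close> by simp
      qed
    qed
  qed
qed

section \<open>Bootstrap of the decay exponent\<close>

text \<open>The constant is chosen before the order \<open>n\<close> and the trajectory. From
  exponent \<open>s\<close> the nonlinear term gets \<open>p = s - 3 / 2\<close>, and damping raises
  it to \<open>p + 2 = s + 1 / 2\<close>, which is the next \<open>i\<close>.\<close>

lemma galerkin_eventually_decay:
  assumes "\<nu> > 0" "V \<ge> 0" and i: "i \<ge> 2"
    and f_smooth: "\<forall>\<gamma>>0. \<exists>M. \<forall>t k. k \<noteq> 0 \<longrightarrow> (knorm k) powr \<gamma> * norm (f t k) \<le> M"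
    and V: "\<And>n t0 u. galerkin_traj \<nu> f n t0 u \<Longrightarrow>
      \<forall>\<^sub>F t in at_top. (\<Sum>k\<in>modes n. mode_enstrophy (u t) k) \<le> V"
  shows "\<exists>C\<ge>0. \<forall>n t0 u. galerkin_traj \<nu> f n t0 u \<longrightarrow>
    (\<forall>\<^sub>F t in at_top. \<forall>k. k \<noteq> 0 \<longrightarrow> norm (u t k) \<le> C / knorm k powr (real i / 2 + 1))"
  using i
proof (induction i rule: dec_induct)
  case base
  \<comment> \<open>Smoothness is assumed for positive exponents, so boundedness of the forcing is
    drawn from exponent 1.\<close>
  obtain M where M: "\<And>t k. k \<noteq> 0 \<Longrightarrow> knorm k powr 1 * norm (f t k) \<le> M"
    using f_smooth by (metis zero_less_one)
  \<comment> \<open>The modulus and the summand 1 make \<open>D\<close> positive whatever the sign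
    of \<open>M\<close>.\<close>
  define D where "D = V + \<bar>M\<bar> + 1"
  have D: "D > 0" using \<open>V \<ge> 0\<close> by (simp add: D_def)
  have f: "norm (f t k) \<le> \<bar>M\<bar>" if "k \<noteq> 0" for t k
  proof -
    have "1 * norm (f t k) \<le> knorm k * norm (f t k)"
      using knorm_ge_1[OF that] by (intro mult_right_mono) auto
    then show ?thesis using M[OF that, of t] by simp
  qed
  show ?case
  proof (intro exI[of _ "2 * D / \<nu>"] conjI allI impI)
    fix n t0 u assume traj: "galerkin_traj \<nu> f n t0 u"
    have "\<forall>\<^sub>F t in at_top. \<forall>k. k \<noteq> 0 \<longrightarrow> norm (nonlin n (u t) k) + norm (f t k) \<le> D * knorm k powr - 0"
      using galerkin_traj_eventually(1)[OF traj] V[OF traj]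
    proof eventually_elim
      case (elim t)
      show ?case
      proof (intro allI impI)
        fix k :: wv assume k: "k \<noteq> 0"
        then have "knorm k \<noteq> 0" using knorm_ge_1[of k] by simp
        then show "norm (nonlin n (u t) k) + norm (f t k) \<le> D * knorm k powr - 0"
          using norm_nonlin_le_enstrophy[OF elim(1), of k] elim(2) f[OF k, of t]
          by (simp add: D_def)
      qed
    qed
    from galerkin_traj_eventually_decay[OF traj \<open>\<nu> > 0\<close> D this]
    show "\<forall>\<^sub>F t in at_top. \<forall>k. k \<noteq> 0 \<longrightarrow> norm (u t k) \<le> (2 * D / \<nu>) / knorm k powr (real 2 / 2 + 1)"
      by simp
  qed (use D \<open>\<nu> > 0\<close> in simp)
next
  case (step i)
  define s where "s = real i / 2 + 1"
  have s: "s \<ge> 2" using \<open>2 \<le> i\<close> by (simp add: s_def)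
  obtain C where C: "C \<ge> 0" and decay: "\<And>n t0 u. galerkin_traj \<nu> f n t0 u \<Longrightarrow>
      \<forall>\<^sub>F t in at_top. \<forall>k. k \<noteq> 0 \<longrightarrow> norm (u t k) \<le> C / knorm k powr s"
    using step.IH unfolding s_def by blast
  \<comment> \<open>The forcing must decay at the same rate as the nonlinear term.\<close>
  have "s - 3 / 2 > 0" using s by simp
  then obtain M where M: "\<And>t k. k \<noteq> 0 \<Longrightarrow> knorm k powr (s - 3 / 2) * norm (f t k) \<le> M"
    using f_smooth by metis
  obtain Z where Z: "Z \<ge> 0" "\<And>F. finite F \<Longrightarrow> 0 \<notin> F \<Longrightarrow> (\<Sum>k\<in>F. 1 / (knorm k) ^ 3) \<le> Z"
    using sum_inverse_knorm_cubed_bounded by blast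
  define B where "B = C\<^sup>2 * 2 powr (2 * s - 3) * Z + V + C * 2 powr (s - 1) * (Z + V)"
  define D where "D = B + \<bar>M\<bar> + 1"
  have "B \<ge> 0" unfolding B_def using C Z(1) \<open>V \<ge> 0\<close> by (intro add_nonneg_nonneg mult_nonneg_nonneg) auto
  then have D: "D > 0" by (simp add: D_def)
  have f: "norm (f t k) \<le> \<bar>M\<bar> * knorm k powr - (s - 3 / 2)" if "k \<noteq> 0" for t k
  proof -
    have "knorm k powr (s - 3 / 2) > 0" using knorm_ge_1[OF that] by simp
    moreover have "knorm k powr (s - 3 / 2) * norm (f t k) \<le> \<bar>M\<bar>" using M[OF that, of t] by simp
    ultimately show ?thesis unfolding powr_minus_divide by (simp add: field_simps)
  qed
  show ?case
  proof (intro exI[of _ "2 * D / \<nu>"] conjI allI impI)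
    fix n t0 u assume traj: "galerkin_traj \<nu> f n t0 u"
    have "\<forall>\<^sub>F t in at_top. \<forall>k. k \<noteq> 0 \<longrightarrow>
        norm (nonlin n (u t) k) + norm (f t k) \<le> D * knorm k powr - (s - 3 / 2)"
      using galerkin_traj_eventually(1)[OF traj] V[OF traj] decay[OF traj]
    proof eventually_elim
      case (elim t)
      show ?case
      proof (intro allI impI)
        fix k :: wv assume k: "k \<noteq> 0"
        have "norm (nonlin n (u t) k) \<le> B * knorm k powr - (s - 3 / 2)"
          using norm_nonlin_le_powr[OF elim(1,2) _ s C k Z(2)] elim(3) unfolding B_def by simp
        moreover have "0 \<le> knorm k powr - (s - 3 / 2)" by simp
        ultimately show "norm (nonlin n (u t) k) + norm (f t k) \<le> D * knorm k powr - (s - 3 / 2)"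
          using f[OF k, of t] unfolding D_def distrib_right by linarith
      qed
    qed
    from galerkin_traj_eventually_decay[OF traj \<open>\<nu> > 0\<close> D this]
    show "\<forall>\<^sub>F t in at_top. \<forall>k. k \<noteq> 0 \<longrightarrow>
        norm (u t k) \<le> (2 * D / \<nu>) / knorm k powr (real (Suc i) / 2 + 1)"
      by (simp add: s_def add_divide_distrib del: split_paired_All)
  qed (use D \<open>\<nu> > 0\<close> in simp)
qed

section \<open>Assembly of the absorbing sets\<close>

theorem mainTheorem3:
  fixes \<nu> :: real and f :: "real \<Rightarrow> field" and V0 :: real
  assumes nu_pos: "\<nu> > 0"
    and f_real: "\<forall>t k. f t (- k) = conj2 (f t k)"
    and f_zero: "\<forall>t. f t 0 = 0"
    and f_smooth: "\<forall>\<gamma>>0. \<exists>M. \<forall>t k. k \<noteq> 0 \<longrightarrow> (knorm k) powr \<gamma> * norm (f t k) \<le> M"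
    and V0_gt: "ennreal V0 > (SUP t. enstrophy (f t)) / ennreal (\<nu>\<^sup>2)"
  shows "(\<exists>A :: nat \<Rightarrow> field set. \<exists>C :: nat \<Rightarrow> real. \<forall>i\<ge>2.
            (\<forall>n. absorbing \<nu> f n (A i)) \<and>
            A i \<subseteq> {u \<in> Hp0. enstrophy u \<le> ennreal V0 \<and>
                     (\<forall>k. k \<noteq> 0 \<longrightarrow> norm (u k) \<le> C i / (knorm k) powr (real i / 2 + 1))})
       \<and> (\<forall>s::nat. s \<ge> 2 \<longrightarrow> (\<exists>Cs. \<forall>n. absorbing \<nu> f n (Wset V0 s Cs)))"
proof -
  \<comment> \<open>\<open>ennreal\<close> sends nonpositive reals to 0, which exceeds
    nothing.\<close>
  have V0: "V0 > 0"
  proof (rule ccontr)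
    assume "\<not> V0 > 0"
    then have "ennreal V0 = 0" by (simp add: ennreal_neg)
    then show False using V0_gt by simp
  qed
  define S where "S = (SUP t. enstrophy (f t))"
  have "S < ennreal V0 * ennreal (\<nu>\<^sup>2)"
    using V0_gt nu_pos unfolding S_def by (subst (asm) divide_less_ennreal) auto
  then have S: "S < ennreal (\<nu>\<^sup>2 * V0)"
    using V0 by (simp add: mult.commute flip: ennreal_mult)
  \<comment> \<open>The supremum lies below a finite value, so it is a real number.\<close>
  then obtain S' where S': "S' \<ge> 0" "S = ennreal S'" by (cases S) auto
  have bound: "(\<Sum>k\<in>modes n. mode_enstrophy (f t) k) \<le> S'" for n t
  proof -
    have "ennreal (\<Sum>k\<in>modes n. mode_enstrophy (f t) k) \<le> S"
      using sum_le_enstrophy[of "modes n" "f t"] SUP_upper[of t UNIV "\<lambda>t. enstrophy (f t)"]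
      unfolding S_def by simp
    then show ?thesis using S' by simp
  qed
  have "S' < \<nu>\<^sup>2 * V0" using S S' by (simp add: ennreal_less_iff)
  then have V: "\<forall>\<^sub>F t in at_top. (\<Sum>k\<in>modes n. mode_enstrophy (u t) k) \<le> V0"
    if "galerkin_traj \<nu> f n t0 u" for n t0 u
    using galerkin_traj_eventually_enstrophy_le[OF that nu_pos bound] by simp
  \<comment> \<open>With a real exponent \<open>r\<close> both families of absorbing sets are
    instances of \<open>W\<close>.\<close>
  define W where "W r C = {u \<in> Hp0. enstrophy u \<le> ennreal V0 \<and>
      (\<forall>k. k \<noteq> 0 \<longrightarrow> norm (u k) \<le> C / (knorm k) powr r)}" for r C
  have "\<exists>C. \<forall>n. absorbing \<nu> f n (W (real i / 2 + 1) C)" if i: "i \<ge> 2" for i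
  proof -
    have "\<exists>C\<ge>0. \<forall>n t0 u. galerkin_traj \<nu> f n t0 u \<longrightarrow>
      (\<forall>\<^sub>F t in at_top. \<forall>k. k \<noteq> 0 \<longrightarrow> norm (u t k) \<le> C / knorm k powr (real i / 2 + 1))"
      by (rule galerkin_eventually_decay[OF nu_pos less_imp_le[OF V0] i f_smooth]) (rule V)
    then obtain C where C: "\<And>n t0 u. galerkin_traj \<nu> f n t0 u \<Longrightarrow>
      \<forall>\<^sub>F t in at_top. \<forall>k. k \<noteq> 0 \<longrightarrow> norm (u t k) \<le> C / knorm k powr (real i / 2 + 1)"
      by blast
    have "\<forall>\<^sub>F t in at_top. u t \<in> W (real i / 2 + 1) C" if traj: "galerkin_traj \<nu> f n t0 u" for n t0 u
      using galerkin_traj_eventually(1)[OF traj] V[OF traj] C[OF traj]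
    proof eventually_elim
      case (elim t)
      have "enstrophy (u t) \<le> ennreal V0"
        unfolding enstrophy_PnHp0[OF elim(1)] using elim(2) by (rule ennreal_leI)
      moreover have "u t \<in> Hp0" using elim(1) by (simp add: PnHp0_def)
      ultimately show ?case using elim(3) unfolding W_def by blast
    qed
    then show ?thesis unfolding absorbing_def eventually_at_top_linorder by blast
  qed
  then obtain C where C: "\<And>i n. i \<ge> 2 \<Longrightarrow> absorbing \<nu> f n (W (real i / 2 + 1) (C i))" by metis
  show ?thesis
  proof (intro conjI allI impI)
    show "\<exists>A :: nat \<Rightarrow> field set. \<exists>C :: nat \<Rightarrow> real. \<forall>i\<ge>2. (\<forall>n. absorbing \<nu> f n (A i)) \<and>
            A i \<subseteq> {u \<in> Hp0. enstrophy u \<le> ennreal V0 \<and>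
                     (\<forall>k. k \<noteq> 0 \<longrightarrow> norm (u k) \<le> C i / (knorm k) powr (real i / 2 + 1))}"
    proof (rule exI[of _ "\<lambda>i. W (real i / 2 + 1) (C i)"], rule exI[of _ C], intro allI impI conjI)
      show "absorbing \<nu> f n (W (real i / 2 + 1) (C i))" if "i \<ge> 2" for i n
        using that by (rule C)
    qed (simp only: W_def order_refl)
  next
    fix s :: nat assume s: "s \<ge> 2"
    \<comment> \<open>The integer exponent \<open>s\<close> is reached at
      \<open>i = 2 * s - 2\<close>, and \<open>s \<ge> 2\<close> ensures
      \<open>i \<ge> 2\<close>.\<close>
    have eq: "real (2 * s - 2) / 2 + 1 = real s" using s by (simp add: of_nat_diff field_simps)
    have "(\<forall>k. k \<noteq> 0 \<longrightarrow> norm (u k) \<le> c / knorm k powr real s) \<longleftrightarrow>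
        (\<forall>k. k \<noteq> 0 \<longrightarrow> norm (u k) \<le> c / knorm k ^ s)" for u :: field and c
    proof (intro all_cong1 imp_cong refl)
      fix k :: wv assume "k \<noteq> 0"
      then have "knorm k > 0" using knorm_ge_1[of k] by simp
      then show "norm (u k) \<le> c / knorm k powr real s \<longleftrightarrow> norm (u k) \<le> c / knorm k ^ s"
        by (simp add: powr_realpow)
    qed
    then have "W (real (2 * s - 2) / 2 + 1) (C (2 * s - 2)) = Wset V0 s (C (2 * s - 2))"
      unfolding eq W_def Wset_def by (simp only:)
    then show "\<exists>Cs. \<forall>n. absorbing \<nu> f n (Wset V0 s Cs)"
      using C[of "2 * s - 2"] s by (intro exI[of _ "C (2 * s - 2)"]) simp
  qed
qed

end
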